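(* Fix $\gamma\in\mathbb R$. With $E(\alpha)$, $F(\alpha)$, $\alpha_2$, $\alpha_4$ as defined in the context, the following asymptotic expansions hold. If $\gamma\le\frac{\omega_1}{2}-\omega_0$, then as $\alpha\downarrow\alpha_2$, $$E(\alpha)=2\omega_0-\omega_1+\gamma-\frac{2(\omega_1-2\omega_0-2\gamma)}{\alpha_2+\alpha_2^3\left\|\frac{\lambda}{\omega+\omega_1-2\omega_0}\right\|^2_{L^2(\mathbb R^d)}}(\alpha-\alpha_2)+o(\alpha-\alpha_2).$$ If $\gamma\ge\frac{\omega_0}{2}-\omega_1$, then as $\alpha\uparrow\alpha_4$, $$F(\alpha)=2\omega_1-\omega_0+\gamma+\frac{2(2\omega_1-\omega_0+2\gamma)}{\alpha_4+\alpha_4^3\left\|\frac{\lambda}{2\omega_1-\omega_0-\omega}\right\|^2_{L^2(\mathbb R^d)}}(\alpha-\alpha_4)+o(\alpha-\alpha_4).$$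
   Context: Standing assumptions: $d\ge1$; $\omega:\mathbb R^d\to[0,\infty)$ is a non-constant, bounded, continuous function; $\lambda\in L^2(\mathbb R^d)$ is complex-valued and not identically zero. Put $\omega_0:=\inf_{\mathbb R^d}\omega$ and $\omega_1:=\sup_{\mathbb R^d}\omega$. For a coupling constant $\alpha>0$ let $\Phi(z)=\Phi_{\gamma,\alpha}(z)=-\gamma-z-\alpha^2\int_{\mathbb R^d}\frac{|\lambda(q)|^2\,dq}{\omega(q)+\gamma-z}$ for $z\in(-\infty,\omega_0+\gamma)\cup(\omega_1+\gamma,\infty)$; it is strictly decreasing on each of the two intervals. $E(\alpha)$ denotes the unique zero of $\Phi_{\gamma,\alpha}$ in $(-\infty,\omega_0+\gamma)$ and $F(\alpha)$ the unique zero of $\Phi_{\gamma,\alpha}$ in $(\omega_1+\gamma,\infty)$, whenever such a zero exists. With $L^2(\mathbb R^d)$-norms, $\alpha_2=\frac{\sqrt{\omega_1-2\omega_0-2\gamma}}{\|\lambda/\sqrt{\omega_1-2\omega_0+\omega}\|}$ for $\gamma\le\frac{\omega_1}{2}-\omega_0$, and $\alpha_4=\frac{\sqrt{2\omega_1-\omega_0+2\gamma}}{\|\lambda/\sqrt{2\omega_1-\omega_0-\omega}\|}$ for $\gamma\ge\frac{\omega_0}{2}-\omega_1$. *)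

theory Defs
  imports "HOL-Analysis.Analysis" "HOL-Library.Landau_Symbols"
begin

definition L2_function :: "(real ^ 'd \<Rightarrow> complex) \<Rightarrow> bool" where
  "L2_function f \<longleftrightarrow>
     f \<in> borel_measurable lebesgue \<and> integrable lebesgue (\<lambda>q. (cmod (f q))\<^sup>2)"

definition L2_norm :: "(real ^ 'd \<Rightarrow> complex) \<Rightarrow> real" where
  "L2_norm f = sqrt (LINT q|lebesgue. (cmod (f q))\<^sup>2)"

definition omega0 :: "(real ^ 'd \<Rightarrow> real) \<Rightarrow> real" where
  "omega0 \<omega> = (INF q. \<omega> q)"

definition omega1 :: "(real ^ 'd \<Rightarrow> real) \<Rightarrow> real" where
  "omega1 \<omega> = (SUP q. \<omega> q)"

(* Phi is meant for z < omega0 + gamma or z > omega1 + gamma; E_zero and F_zero below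
   evaluate it only there. *)
definition Phi ::
  "(real ^ 'd \<Rightarrow> real) \<Rightarrow> (real ^ 'd \<Rightarrow> complex) \<Rightarrow> real \<Rightarrow> real \<Rightarrow> real \<Rightarrow> real" where
  "Phi \<omega> lam \<gamma> \<alpha> z =
     - \<gamma> - z - \<alpha>\<^sup>2 * (LINT q|lebesgue. (cmod (lam q))\<^sup>2 / (\<omega> q + \<gamma> - z))"

definition is_E_zero ::
  "(real ^ 'd \<Rightarrow> real) \<Rightarrow> (real ^ 'd \<Rightarrow> complex) \<Rightarrow> real \<Rightarrow> real \<Rightarrow> real \<Rightarrow> bool" where
  "is_E_zero \<omega> lam \<gamma> \<alpha> z \<longleftrightarrow> z \<in> {..<omega0 \<omega> + \<gamma>} \<and> Phi \<omega> lam \<gamma> \<alpha> z = 0"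

definition is_F_zero ::
  "(real ^ 'd \<Rightarrow> real) \<Rightarrow> (real ^ 'd \<Rightarrow> complex) \<Rightarrow> real \<Rightarrow> real \<Rightarrow> real \<Rightarrow> bool" where
  "is_F_zero \<omega> lam \<gamma> \<alpha> z \<longleftrightarrow> z \<in> {omega1 \<omega> + \<gamma><..} \<and> Phi \<omega> lam \<gamma> \<alpha> z = 0"

(* E_zero and F_zero are meaningful only where a unique zero exists; statements about them
   have to assert this separately. *)
definition E_zero ::
  "(real ^ 'd \<Rightarrow> real) \<Rightarrow> (real ^ 'd \<Rightarrow> complex) \<Rightarrow> real \<Rightarrow> real \<Rightarrow> real" where
  "E_zero \<omega> lam \<gamma> \<alpha> = (THE z. is_E_zero \<omega> lam \<gamma> \<alpha> z)"

definition F_zero ::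
  "(real ^ 'd \<Rightarrow> real) \<Rightarrow> (real ^ 'd \<Rightarrow> complex) \<Rightarrow> real \<Rightarrow> real \<Rightarrow> real" where
  "F_zero \<omega> lam \<gamma> \<alpha> = (THE z. is_F_zero \<omega> lam \<gamma> \<alpha> z)"

definition alpha2 ::
  "(real ^ 'd \<Rightarrow> real) \<Rightarrow> (real ^ 'd \<Rightarrow> complex) \<Rightarrow> real \<Rightarrow> real" where
  "alpha2 \<omega> lam \<gamma> =
     sqrt (omega1 \<omega> - 2 * omega0 \<omega> - 2 * \<gamma>) /
     L2_norm (\<lambda>q. lam q / complex_of_real (sqrt (omega1 \<omega> - 2 * omega0 \<omega> + \<omega> q)))"

definition alpha4 ::
  "(real ^ 'd \<Rightarrow> real) \<Rightarrow> (real ^ 'd \<Rightarrow> complex) \<Rightarrow> real \<Rightarrow> real" where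
  "alpha4 \<omega> lam \<gamma> =
     sqrt (2 * omega1 \<omega> - omega0 \<omega> + 2 * \<gamma>) /
     L2_norm (\<lambda>q. lam q / complex_of_real (sqrt (2 * omega1 \<omega> - omega0 \<omega> - \<omega> q)))"

end

theory Submission
  imports Defs
begin

text \<open>
  Write \<open>I z\<close> for the integral in \<^const>\<open>Phi\<close>; it is differentiable and increasing on each of the two
  intervals. Let \<open>z\<^sub>0\<close> be the claimed limit of the zero and \<open>a\<close> the critical coupling constant
  (\<^const>\<open>alpha2\<close> or \<^const>\<open>alpha4\<close>), which is chosen so that \<open>- \<gamma> - z\<^sub>0 = a\<^sup>2 * I z\<^sub>0\<close>.
  Subtracting the equations for \<open>z\<close> and \<open>z\<^sub>0\<close> yields the exact identity
  \<open>(z - z\<^sub>0) * (1 + \<alpha>\<^sup>2 * g z) = - (\<alpha>\<^sup>2 - a\<^sup>2) * I z\<^sub>0\<close>, where \<open>g \<ge> 0\<close> is the difference quotient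
  of \<open>I\<close> at \<open>z\<^sub>0\<close>. It bounds \<open>\<bar>z - z\<^sub>0\<bar>\<close> by \<open>\<bar>\<alpha>\<^sup>2 - a\<^sup>2\<bar> * \<bar>I z\<^sub>0\<bar>\<close>, so the zero converges to \<open>z\<^sub>0\<close>, and
  then it gives the slope of the zero at \<open>a\<close>. For the boundary values of \<open>\<gamma>\<close> we
  have \<open>a = 0\<close>, and the junk value \<open>0 / 0 = 0\<close> of the stated slope is the true slope.
\<close>

section \<open>Differentiation of resolvent-type integrals\<close>

text \<open>A quantitative estimate takes the place of dominated convergence: since \<open>w\<close>
  keeps the distance \<open>r\<close> from all values of \<open>a\<close>, the difference quotient
  misses the claimed derivative by at most a constant times
  \<open>\<bar>z - w\<bar>\<close>.\<close>

lemma has_real_derivative_resolvent_integral: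
  fixes p a :: "'a \<Rightarrow> real"
  assumes p: "integrable M p" and p0: "\<And>q. 0 \<le> p q"
    and a: "a \<in> borel_measurable M"
    and r: "0 < r" "\<And>q. r \<le> \<bar>a q - w\<bar>"
  shows "((\<lambda>z. LINT q|M. p q / (a q - z)) has_real_derivative (LINT q|M. p q / (a q - w)\<^sup>2)) (at w)"
proof -
  have pm[measurable]: "p \<in> borel_measurable M" and am[measurable]: "a \<in> borel_measurable M"
    using p a by auto
  \<comment> \<open>The factor \<open>2 / r^3\<close> bounds
    \<open>1 / (\<bar>a q - z\<bar> * (a q - w)\<^sup>2)\<close>: for
    \<open>\<bar>z - w\<bar> < r / 2\<close> the first factor of the denominator is still at least
    \<open>r / 2\<close>, the second at least \<open>r\<^sup>2\<close>.\<close>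
  define C where "C = 2 / r^3 * (LINT q|M. p q)"
  have bound: "\<bar>(I z - I w) / (z - w) - D\<bar> \<le> C * \<bar>z - w\<bar>"
    if I: "I = (\<lambda>z. LINT q|M. p q / (a q - z))" and D: "D = (LINT q|M. p q / (a q - w)\<^sup>2)"
      and z: "z \<noteq> w" "\<bar>z - w\<bar> < r / 2" for z I D
  proof -
    have lw: "r \<le> \<bar>a q - w\<bar>" and lz: "r / 2 \<le> \<bar>a q - z\<bar>" for q
      using r(2)[of q] z(2) by linarith+
    have iz: "integrable M (\<lambda>q. p q / (a q - z))"
    proof (rule Bochner_Integration.integrable_bound)
      show "integrable M (\<lambda>q. p q * (2 / r))" using p by simp
      have "p q / \<bar>a q - z\<bar> \<le> p q / (r / 2)" for q
        using lz[of q] r(1) p0[of q] by (intro divide_left_mono mult_pos_pos) auto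
      thus "AE q in M. norm (p q / (a q - z)) \<le> norm (p q * (2 / r))"
        using p0 r(1) by (simp add: abs_mult)
    qed simp
    have iw: "integrable M (\<lambda>q. p q / (a q - w))"
    proof (rule Bochner_Integration.integrable_bound)
      show "integrable M (\<lambda>q. p q * (1 / r))" using p by simp
      have "p q / \<bar>a q - w\<bar> \<le> p q / r" for q
        using lw[of q] r(1) p0[of q] by (intro divide_left_mono mult_pos_pos) auto
      thus "AE q in M. norm (p q / (a q - w)) \<le> norm (p q * (1 / r))"
        using p0 r(1) by (simp add: abs_mult)
    qed simp
    have iw2: "integrable M (\<lambda>q. p q / (a q - w)\<^sup>2)"
    proof (rule Bochner_Integration.integrable_bound)
      show "integrable M (\<lambda>q. p q * (1 / r\<^sup>2))" using p by simp
      have "p q / (a q - w)\<^sup>2 \<le> p q / r\<^sup>2" for q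
      proof (rule divide_left_mono)
        show "r\<^sup>2 \<le> (a q - w)\<^sup>2" using lw[of q] r(1) by (simp add: abs_le_square_iff[symmetric])
        show "0 < (a q - w)\<^sup>2 * r\<^sup>2" using lw[of q] r(1) by auto
      qed (rule p0)
      thus "AE q in M. norm (p q / (a q - w)\<^sup>2) \<le> norm (p q * (1 / r\<^sup>2))"
        using p0 by simp
    qed simp
    \<comment> \<open>With \<open>A = a q - w\<close> and \<open>B = a q - z\<close> one has
      \<open>A - B = z - w\<close>. The quotient is thus \<open>p q / (A * B)\<close>, and
      subtracting \<open>p q / A\<^sup>2\<close> leaves another factor \<open>A - B\<close>, which
      makes the error of first order.\<close>
    have pt: "(p q / (a q - z) - p q / (a q - w)) / (z - w) - p q / (a q - w)\<^sup>2
        = (z - w) * p q / ((a q - z) * (a q - w)\<^sup>2)" for q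
    proof -
      define A B where "A = a q - w" and "B = a q - z"
      have nz: "A \<noteq> 0" "B \<noteq> 0" "A - B \<noteq> 0"
        using lz[of q] lw[of q] r(1) z(1) unfolding A_def B_def by auto
      have "p q / B - p q / A = p q * (A - B) / (A * B)"
        using nz by (simp add: field_simps)
      hence "(p q / B - p q / A) / (A - B) = p q / (A * B)"
        using nz(3) by simp
      moreover have "p q / (A * B) = A * p q / (B * A\<^sup>2)" "p q / A\<^sup>2 = B * p q / (B * A\<^sup>2)"
        using nz(1,2) by (simp_all add: power2_eq_square)
      hence "p q / (A * B) - p q / A\<^sup>2 = (A - B) * p q / (B * A\<^sup>2)"
        by (simp only: diff_divide_distrib[symmetric] left_diff_distrib)
      moreover have "z - w = A - B" unfolding A_def B_def by simp
      ultimately show ?thesis unfolding A_def[symmetric] B_def[symmetric] by (simp only:)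
    qed
    have "(I z - I w) / (z - w) - D
        = (LINT q|M. (p q / (a q - z) - p q / (a q - w)) / (z - w) - p q / (a q - w)\<^sup>2)"
      unfolding I D using iz iw iw2 by simp
    also have "\<bar>\<dots>\<bar> \<le> (LINT q|M. \<bar>z - w\<bar> * (2 / r^3) * p q)"
    proof (rule order_trans[OF integral_abs_bound integral_mono])
      show "integrable M (\<lambda>q. \<bar>(p q / (a q - z) - p q / (a q - w)) / (z - w) - p q / (a q - w)\<^sup>2\<bar>)"
        using iz iw iw2 by simp
      show "integrable M (\<lambda>q. \<bar>z - w\<bar> * (2 / r^3) * p q)" using p by simp
      fix q
      have "r / 2 * r\<^sup>2 \<le> \<bar>a q - z\<bar> * \<bar>a q - w\<bar>\<^sup>2"
        using lz[of q] lw[of q] r(1) by (intro mult_mono power_mono) auto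
      hence "r^3 / 2 \<le> \<bar>a q - z\<bar> * (a q - w)\<^sup>2"
        by (simp add: power2_eq_square power3_eq_cube)
      moreover have "0 < \<bar>a q - z\<bar> * (a q - w)\<^sup>2 * (r^3 / 2)"
        using lz[of q] lw[of q] r(1) by (intro mult_pos_pos) auto
      ultimately have "\<bar>z - w\<bar> * p q / (\<bar>a q - z\<bar> * (a q - w)\<^sup>2) \<le> \<bar>z - w\<bar> * p q / (r^3 / 2)"
        using p0[of q] by (intro divide_left_mono) auto
      thus "\<bar>(p q / (a q - z) - p q / (a q - w)) / (z - w) - p q / (a q - w)\<^sup>2\<bar>
          \<le> \<bar>z - w\<bar> * (2 / r^3) * p q"
        unfolding pt using p0[of q] by (simp add: abs_mult mult_ac)
    qed
    also have "\<dots> = C * \<bar>z - w\<bar>" by (simp add: C_def)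
    finally show ?thesis .
  qed
  have lim: "((\<lambda>z. C * \<bar>z - w\<bar>) \<longlongrightarrow> 0) (at w)"
    by (rule tendsto_eq_intros | simp)+
  have ev: "\<forall>\<^sub>F z in at w. z \<noteq> w \<and> \<bar>z - w\<bar> < r / 2"
    unfolding eventually_at using r(1) by (intro exI[of _ "r / 2"]) (auto simp: dist_real_def)
  show ?thesis
    unfolding has_field_derivative_iff
    by (rule LIM_zero_cancel, rule Lim_null_comparison[OF _ lim], rule eventually_mono[OF ev])
      (use bound[OF refl refl] in auto)
qed

section \<open>Zeros of a strictly decreasing function under a change of coupling\<close>

text \<open>The slope is what implicit differentiation of
  \<open>- \<gamma> - z = \<alpha>\<^sup>2 * I z\<close> at \<open>(a, z0)\<close> predicts. The
  expansion is two-sided in \<alpha> and covers \<open>a = 0\<close>.\<close>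

lemma perturbed_zero_expansion:
  fixes I I' :: "real \<Rightarrow> real" and S :: "real set" and \<gamma> :: real
  defines "Z \<equiv> \<lambda>\<alpha> z. z \<in> S \<and> - \<gamma> - z - \<alpha>\<^sup>2 * I z = 0"
  assumes S: "open S" "is_interval S" and z0: "z0 \<in> S"
    and D: "\<And>z. z \<in> S \<Longrightarrow> (I has_real_derivative I' z) (at z)"
    and I'_nonneg: "\<And>z. z \<in> S \<Longrightarrow> 0 \<le> I' z"
    and a: "- \<gamma> - z0 = a\<^sup>2 * I z0"
  shows "\<forall>\<^sub>F \<alpha> in at a. \<exists>!z. Z \<alpha> z"
    and "(\<lambda>\<alpha>. (THE z. Z \<alpha> z) - (z0 - 2 * a * I z0 / (1 + a\<^sup>2 * I' z0) * (\<alpha> - a)))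
           \<in> o[at a](\<lambda>\<alpha>. \<alpha> - a)"
proof -
  have mono: "I x \<le> I y" if "x \<in> S" "y \<in> S" "x \<le> y" for x y
  proof (rule DERIV_nonneg_imp_nondecreasing[OF that(3)])
    fix t assume "x \<le> t" "t \<le> y"
    hence "t \<in> S" using S(2) that(1,2) unfolding is_interval_1 by blast
    thus "\<exists>d. (I has_real_derivative d) (at t) \<and> 0 \<le> d" using D I'_nonneg by blast
  qed
  have strict: "- \<gamma> - y - \<alpha>\<^sup>2 * I y < - \<gamma> - x - \<alpha>\<^sup>2 * I x"
    if "x \<in> S" "y \<in> S" "x < y" for x y \<alpha>
    using mult_left_mono[OF mono[of x y], of "\<alpha>\<^sup>2"] that by simp
  have uniq: "x = y" if "Z \<alpha> x" "Z \<alpha> y" for \<alpha> x y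
    using that strict[of x y \<alpha>] strict[of y x \<alpha>] unfolding Z_def by (cases x y rule: linorder_cases) auto
  \<comment> \<open>Caratheodory's form of the derivative gives a difference quotient that is also
    defined at \<open>z0\<close>, with the value \<open>I' z0\<close>, so \<open>z = z0\<close>
    needs no separate treatment below.\<close>
  obtain g where g: "\<And>z. I z - I z0 = g z * (z - z0)" "isCont g z0" "g z0 = I' z0"
    using D[OF z0] unfolding CARAT_DERIV by blast
  have g0: "0 \<le> g z" if "z \<in> S" for z
  proof (cases z z0 rule: linorder_cases)
    case less
    with mono[of z z0] that z0 g(1)[of z] have "g z * (z - z0) \<le> 0" by simp
    thus ?thesis using less by (simp add: mult_le_0_iff)
  next
    case equal thus ?thesis using g(3) I'_nonneg[OF z0] by simp
  next
    case greater
    with mono[of z0 z] that z0 g(1)[of z] have "0 \<le> g z * (z - z0)" by simp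
    thus ?thesis using greater by (simp add: zero_le_mult_iff)
  qed
  \<comment> \<open>The criticality equation for \<open>a\<close> eliminates \<gamma>, and
    \<open>g\<close> turns \<open>I z - I z0\<close> into a multiple of
    \<open>z - z0\<close>.\<close>
  have key: "- \<gamma> - z - \<alpha>\<^sup>2 * I z = - ((z - z0) * (1 + \<alpha>\<^sup>2 * g z)) - (\<alpha>\<^sup>2 - a\<^sup>2) * I z0" for z \<alpha>
  proof -
    have "I z = I z0 + g z * (z - z0)" using g(1)[of z] by simp
    moreover have "\<gamma> = - z0 - a\<^sup>2 * I z0" using a by simp
    ultimately show ?thesis by (simp only:) (simp add: algebra_simps)
  qed
  \<comment> \<open>Since \<open>1 + \<alpha>\<^sup>2 * g z\<close> is at least 1,
    \<open>b \<alpha>\<close> bounds the distance of a zero from \<open>z0\<close>. It serves both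
    existence and convergence.\<close>
  define b where "b = (\<lambda>\<alpha>. \<bar>\<alpha>\<^sup>2 - a\<^sup>2\<bar> * \<bar>I z0\<bar>)"
  have b_lim: "(b \<longlongrightarrow> 0) (at a)"
    unfolding b_def by (rule tendsto_eq_intros | simp)+
  obtain r where r: "0 < r" "cball z0 r \<subseteq> S" using S(1) z0 open_contains_cball by blast
  have ev: "\<forall>\<^sub>F \<alpha> in at a. b \<alpha> < r" using b_lim r(1) by (rule order_tendstoD(2))
  \<comment> \<open>Intermediate value theorem on the interval of radius \<open>r\<close>: at its
    endpoints the first term in \<open>key\<close> has modulus at least \<open>r\<close> and
    opposite signs, while the second has modulus \<open>b \<alpha> < r\<close> and cannot reverse
    them.\<close>
  have ex: "\<exists>z. Z \<alpha> z" if "b \<alpha> < r" for \<alpha>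
  proof -
    have sub: "{z0 - r..z0 + r} \<subseteq> S" using r(2) by (simp add: cball_eq_atLeastAtMost)
    have c: "continuous_on {z0 - r..z0 + r} (\<lambda>z. - \<gamma> - z - \<alpha>\<^sup>2 * I z)"
    proof (intro continuous_intros continuous_at_imp_continuous_on ballI)
      fix z assume "z \<in> {z0 - r..z0 + r}" thus "isCont I z" using sub D DERIV_isCont by blast
    qed
    have bb: "\<bar>(\<alpha>\<^sup>2 - a\<^sup>2) * I z0\<bar> < r" using that by (simp add: b_def abs_mult)
    have le: "r * 1 \<le> r * (1 + \<alpha>\<^sup>2 * g z)" if "z \<in> S" for z
      using g0[OF that] r(1) by (intro mult_left_mono) auto
    have "z0 - r \<in> S" "z0 + r \<in> S" using sub r(1) by auto
    note this[THEN le]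
    moreover have "z0 + r - z0 = r" "z0 - r - z0 = - r" by simp_all
    ultimately have "- \<gamma> - (z0 + r) - \<alpha>\<^sup>2 * I (z0 + r) \<le> 0 \<and> 0 \<le> - \<gamma> - (z0 - r) - \<alpha>\<^sup>2 * I (z0 - r)"
      unfolding key using bb by (simp only: mult_minus_left) linarith
    hence "- \<gamma> - (z0 + r) - \<alpha>\<^sup>2 * I (z0 + r) \<le> 0" "0 \<le> - \<gamma> - (z0 - r) - \<alpha>\<^sup>2 * I (z0 - r)"
      by blast+
    from IVT2'[OF this _ c] r(1) sub show ?thesis unfolding Z_def by auto
  qed
  show ev1: "\<forall>\<^sub>F \<alpha> in at a. \<exists>!z. Z \<alpha> z"
    using ev by (rule eventually_mono) (use ex uniq in blast)
  define E where "E = (\<lambda>\<alpha>. THE z. Z \<alpha> z)"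
  have evE: "\<forall>\<^sub>F \<alpha> in at a. Z \<alpha> (E \<alpha>)"
    using ev1 unfolding E_def by (rule eventually_mono) (rule theI')
  have E: "1 \<le> 1 + \<alpha>\<^sup>2 * g (E \<alpha>)" "E \<alpha> - z0 = - ((\<alpha>\<^sup>2 - a\<^sup>2) * I z0) / (1 + \<alpha>\<^sup>2 * g (E \<alpha>))"
    "\<bar>E \<alpha> - z0\<bar> \<le> b \<alpha>" if "Z \<alpha> (E \<alpha>)" for \<alpha>
  proof -
    show 1: "1 \<le> 1 + \<alpha>\<^sup>2 * g (E \<alpha>)" using g0 that unfolding Z_def by auto
    have "(E \<alpha> - z0) * (1 + \<alpha>\<^sup>2 * g (E \<alpha>)) = - ((\<alpha>\<^sup>2 - a\<^sup>2) * I z0)"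
      using that unfolding Z_def key by simp
    moreover have "1 + \<alpha>\<^sup>2 * g (E \<alpha>) \<noteq> 0" using 1 by linarith
    ultimately show 2: "E \<alpha> - z0 = - ((\<alpha>\<^sup>2 - a\<^sup>2) * I z0) / (1 + \<alpha>\<^sup>2 * g (E \<alpha>))"
      by (metis nonzero_eq_divide_eq)
    have "\<bar>(\<alpha>\<^sup>2 - a\<^sup>2) * I z0\<bar> / (1 + \<alpha>\<^sup>2 * g (E \<alpha>)) \<le> \<bar>(\<alpha>\<^sup>2 - a\<^sup>2) * I z0\<bar> / 1"
      using 1 by (intro divide_left_mono) auto
    thus "\<bar>E \<alpha> - z0\<bar> \<le> b \<alpha>" unfolding 2 b_def using 1 by (simp add: abs_mult)
  qed
  have "(E \<longlongrightarrow> z0) (at a)"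
    by (rule LIM_zero_cancel, rule Lim_null_comparison[OF _ b_lim], rule eventually_mono[OF evE])
      (use E(3) in simp)
  hence gE: "((\<lambda>\<alpha>. g (E \<alpha>)) \<longlongrightarrow> I' z0) (at a)"
    using isCont_tendsto_compose[OF g(2)] g(3) by simp
  have pos: "1 + a\<^sup>2 * I' z0 \<noteq> 0"
    using I'_nonneg[OF z0] by (metis add_pos_nonneg less_irrefl mult_nonneg_nonneg zero_le_power2 zero_less_one)
  have "((\<lambda>\<alpha>. - ((\<alpha> + a) * I z0) / (1 + \<alpha>\<^sup>2 * g (E \<alpha>)) + 2 * a * I z0 / (1 + a\<^sup>2 * I' z0)) \<longlongrightarrow>
      - ((a + a) * I z0) / (1 + a\<^sup>2 * I' z0) + 2 * a * I z0 / (1 + a\<^sup>2 * I' z0)) (at a)"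
    by (intro tendsto_intros gE pos)
  hence lim: "((\<lambda>\<alpha>. - ((\<alpha> + a) * I z0) / (1 + \<alpha>\<^sup>2 * g (E \<alpha>)) + 2 * a * I z0 / (1 + a\<^sup>2 * I' z0)) \<longlongrightarrow> 0) (at a)"
    by simp
  have ne: "\<forall>\<^sub>F \<alpha> in at a. \<alpha> - a \<noteq> 0"
    unfolding eventually_at by (intro exI[of _ 1]) auto
  \<comment> \<open>The factorisation \<open>\<alpha>\<^sup>2 - a\<^sup>2 = (\<alpha> + a) *
    (\<alpha> - a)\<close> lets the displacement be divided by \<open>\<alpha> - a\<close> exactly;
    what remains converges by \<open>lim\<close>.\<close>
  have quot: "\<forall>\<^sub>F \<alpha> in at a. - ((\<alpha> + a) * I z0) / (1 + \<alpha>\<^sup>2 * g (E \<alpha>)) + 2 * a * I z0 / (1 + a\<^sup>2 * I' z0)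
      = (E \<alpha> - (z0 - 2 * a * I z0 / (1 + a\<^sup>2 * I' z0) * (\<alpha> - a))) / (\<alpha> - a)"
    using evE ne
  proof eventually_elim
    case (elim \<alpha>)
    have "E \<alpha> - z0 = - ((\<alpha> + a) * I z0) / (1 + \<alpha>\<^sup>2 * g (E \<alpha>)) * (\<alpha> - a)"
      unfolding E(2)[OF elim(1)] by (simp add: power2_eq_square algebra_simps)
    hence "E \<alpha> - (z0 - 2 * a * I z0 / (1 + a\<^sup>2 * I' z0) * (\<alpha> - a)) =
        (- ((\<alpha> + a) * I z0) / (1 + \<alpha>\<^sup>2 * g (E \<alpha>)) + 2 * a * I z0 / (1 + a\<^sup>2 * I' z0)) * (\<alpha> - a)"
      by (simp only: distrib_right)
    thus ?case using elim(2) by simp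
  qed
  show "(\<lambda>\<alpha>. (THE z. Z \<alpha> z) - (z0 - 2 * a * I z0 / (1 + a\<^sup>2 * I' z0) * (\<alpha> - a)))
           \<in> o[at a](\<lambda>\<alpha>. \<alpha> - a)"
    using smalloI_tendsto[OF Lim_transform_eventually[OF lim quot] ne] unfolding E_def .
qed

section \<open>Weighted square norms\<close>

text \<open>Keeps the denominators of the critical couplings away from zero. Square integrability
  matters: the Bochner integral of a non-integrable function is 0 by convention, and
  \<open>L2_norm\<close> would then vanish.\<close>

lemma L2_norm_pos:
  assumes f: "L2_function f" and nz: "\<not> (AE q in lebesgue. f q = 0)"
  shows "0 < L2_norm f"
proof -
  have "(LINT q|lebesgue. (cmod (f q))\<^sup>2) \<noteq> 0"
    using integral_nonneg_eq_0_iff_AE[of lebesgue "\<lambda>q. (cmod (f q))\<^sup>2"] f nz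
    unfolding L2_function_def by auto
  moreover have "0 \<le> (LINT q|lebesgue. (cmod (f q))\<^sup>2)" by simp
  ultimately show ?thesis unfolding L2_norm_def real_sqrt_gt_0_iff by linarith
qed

lemma L2_norm_divide_sqrt:
  assumes "\<And>q. 0 \<le> b q"
  shows "(L2_norm (\<lambda>q. f q / complex_of_real (sqrt (b q))))\<^sup>2 = (LINT q|lebesgue. (cmod (f q))\<^sup>2 / b q)"
  unfolding L2_norm_def using assms by (simp add: norm_divide power_divide)

lemma L2_norm_divide:
  "(L2_norm (\<lambda>q. f q / complex_of_real (b q)))\<^sup>2 = (LINT q|lebesgue. (cmod (f q))\<^sup>2 / (b q)\<^sup>2)"
  unfolding L2_norm_def by (simp add: norm_divide power_divide)

lemma L2_function_divide_sqrt:
  assumes f: "L2_function f" and b: "b \<in> borel_measurable lebesgue"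
    and r: "0 < r" "\<And>q. r \<le> b q"
  shows "L2_function (\<lambda>q. f q / complex_of_real (sqrt (b q)))"
proof -
  have [measurable]: "f \<in> borel_measurable lebesgue" "b \<in> borel_measurable lebesgue"
    using f b unfolding L2_function_def by auto
  have "integrable lebesgue (\<lambda>q. (cmod (f q / complex_of_real (sqrt (b q))))\<^sup>2)"
  proof (rule Bochner_Integration.integrable_bound)
    show "integrable lebesgue (\<lambda>q. (cmod (f q))\<^sup>2 / r)"
      using f unfolding L2_function_def by simp
    have "(cmod (f q))\<^sup>2 / b q \<le> (cmod (f q))\<^sup>2 / r" "0 < b q" for q
      using r(1) r(2)[of q] by (auto intro!: divide_left_mono mult_pos_pos)
    thus "AE q in lebesgue. norm ((cmod (f q / complex_of_real (sqrt (b q))))\<^sup>2) \<le> norm ((cmod (f q))\<^sup>2 / r)"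
      using r(1) by (simp add: norm_divide power_divide less_imp_le)
  qed measurable
  thus ?thesis unfolding L2_function_def by simp
qed

section \<open>The expansion at the critical coupling, for both sides of the band at once\<close>

text \<open>The sign \<open>s\<close> is \<open>1\<close> below the range of \<open>\<omega> + \<gamma>\<close> and \<open>-1\<close> above it.\<close>

lemma critical_expansion:
  fixes \<omega> :: "real ^ 'd \<Rightarrow> real" and lam :: "real ^ 'd \<Rightarrow> complex"
    and S :: "real set" and \<gamma> :: real
  defines "Z \<equiv> \<lambda>\<alpha> z. z \<in> S \<and> Phi \<omega> lam \<gamma> \<alpha> z = 0"
  assumes \<omega>: "\<omega> \<in> borel_measurable lebesgue"
    and lam_L2: "L2_function lam" and lam_nz: "\<not> (AE q in lebesgue. lam q = 0)"
    and S: "open S" "is_interval S" "z0 \<in> S"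
    and gap: "\<And>z. z \<in> S \<Longrightarrow> \<exists>r>0. \<forall>q. r \<le> s * (\<omega> q + \<gamma> - z)"
    and s: "\<bar>s\<bar> = 1" and n: "n = s * (- \<gamma> - z0)" "0 \<le> n"
    and b: "\<And>q. b q = s * (\<omega> q + \<gamma> - z0)"
    and a: "a = sqrt n / L2_norm (\<lambda>q. lam q / complex_of_real (sqrt (b q)))"
  shows "\<forall>\<^sub>F \<alpha> in at a. \<exists>!z. Z \<alpha> z"
    and "(\<lambda>\<alpha>. (THE z. Z \<alpha> z) -
           (z0 - s * (2 * n / (a + a ^ 3 * (L2_norm (\<lambda>q. lam q / complex_of_real (b q)))\<^sup>2) * (\<alpha> - a))))
         \<in> o[at a](\<lambda>\<alpha>. \<alpha> - a)"
proof -
  define I where "I z = (LINT q|lebesgue. (cmod (lam q))\<^sup>2 / (\<omega> q + \<gamma> - z))" for z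
  define I' where "I' z = (LINT q|lebesgue. (cmod (lam q))\<^sup>2 / (\<omega> q + \<gamma> - z)\<^sup>2)" for z
  have ss: "s * s = 1" using s by (metis abs_mult_self_eq mult_1)
  hence inv_s: "inverse s = s" by (rule inverse_unique)
  have b_borel: "b \<in> borel_measurable lebesgue"
    using \<omega> unfolding b[abs_def] by measurable
  obtain r0 where r0: "0 < r0" "\<And>q. r0 \<le> b q"
    using gap[OF S(3)] unfolding b[symmetric] by blast
  have b_pos: "0 < b q" for q using r0(1) r0(2)[of q] by linarith
  have lam_int: "integrable lebesgue (\<lambda>q. (cmod (lam q))\<^sup>2)"
    using lam_L2 unfolding L2_function_def by simp
  have D: "(I has_real_derivative I' z) (at z)" if z: "z \<in> S" for z
  proof -
    obtain r where r: "0 < r" "\<And>q. r \<le> s * (\<omega> q + \<gamma> - z)" using gap[OF z] by blast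
    have "r \<le> \<bar>\<omega> q + \<gamma> - z\<bar>" for q
    proof -
      have "\<bar>s * (\<omega> q + \<gamma> - z)\<bar> = \<bar>\<omega> q + \<gamma> - z\<bar>" unfolding abs_mult s by simp
      thus ?thesis using r(2)[of q] by linarith
    qed
    moreover have "(\<lambda>q. \<omega> q + \<gamma>) \<in> borel_measurable lebesgue" using \<omega> by measurable
    ultimately show ?thesis unfolding I_def[abs_def] I'_def
      using lam_int r(1) by (intro has_real_derivative_resolvent_integral) auto
  qed
  define N where "N = L2_norm (\<lambda>q. lam q / complex_of_real (sqrt (b q)))"
  have "0 < N" unfolding N_def
  proof (rule L2_norm_pos)
    show "L2_function (\<lambda>q. lam q / complex_of_real (sqrt (b q)))"
      using lam_L2 b_borel r0 by (rule L2_function_divide_sqrt)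
    have "sqrt (b q) \<noteq> 0" for q using b_pos[of q] by simp
    thus "\<not> (AE q in lebesgue. lam q / complex_of_real (sqrt (b q)) = 0)" using lam_nz by simp
  qed
  \<comment> \<open>As \<open>inverse s = s\<close>, the sign moves out of the denominator, so the
    squared norm is the resolvent integral at \<open>z0\<close> up to sign.\<close>
  have "N\<^sup>2 = (LINT q|lebesgue. (cmod (lam q))\<^sup>2 / b q)"
    unfolding N_def using b_pos by (intro L2_norm_divide_sqrt) (simp add: less_imp_le)
  also have "\<dots> = (LINT q|lebesgue. s * ((cmod (lam q))\<^sup>2 / (\<omega> q + \<gamma> - z0)))"
  proof (rule Bochner_Integration.integral_cong[OF refl])
    fix q show "(cmod (lam q))\<^sup>2 / b q = s * ((cmod (lam q))\<^sup>2 / (\<omega> q + \<gamma> - z0))"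
      unfolding b divide_inverse inverse_mult_distrib inv_s by (simp only: mult_ac)
  qed
  also have "\<dots> = s * I z0" unfolding I_def by (rule integral_mult_right_zero)
  finally have N2: "N\<^sup>2 = s * I z0" .
  have aN: "a\<^sup>2 * N\<^sup>2 = n"
    using \<open>0 < N\<close> n(2) unfolding a N_def[symmetric] by (simp add: power_divide)
  \<comment> \<open>Both sides equal \<open>n\<close>; cancelling the sign shows that
    \<open>a\<close> is the coupling for which \<open>z0\<close> is a zero.\<close>
  have "s * (- \<gamma> - z0) = s * (a\<^sup>2 * I z0)" using aN unfolding N2 n(1) by (metis mult.left_commute)
  moreover have "s \<noteq> 0" using s by auto
  ultimately have zero: "- \<gamma> - z0 = a\<^sup>2 * I z0" by (metis mult_left_cancel)
  have b2: "(b q)\<^sup>2 = (\<omega> q + \<gamma> - z0)\<^sup>2" for q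
    using ss unfolding b power_mult_distrib by (simp add: power2_eq_square)
  have K: "(L2_norm (\<lambda>q. lam q / complex_of_real (b q)))\<^sup>2 = I' z0"
    unfolding L2_norm_divide b2 I'_def ..
  have I'_nonneg: "0 \<le> I' z" for z unfolding I'_def by simp
  have "0 < 1 + a\<^sup>2 * I' z0" using I'_nonneg[of z0] by (simp add: add_pos_nonneg)
  \<comment> \<open>For nonzero \<open>a\<close>, insert \<open>n = a\<^sup>2 * s * I z0\<close> and
    cancel \<open>a\<close>. For \<open>a = 0\<close>, \<open>aN\<close> forces
    \<open>n = 0\<close>, and the right-hand side is \<open>0 / 0 = 0\<close>, in agreement with the
    left.\<close>
  hence slope: "2 * a * I z0 / (1 + a\<^sup>2 * I' z0) = s * (2 * n / (a + a ^ 3 * I' z0))"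
  proof (cases "a = 0")
    case False
    have "s * (2 * n / (a + a ^ 3 * I' z0)) = (2 * a * (s * s) * I z0 * a) / ((1 + a\<^sup>2 * I' z0) * a)"
      unfolding aN[symmetric] N2 by (simp add: power2_eq_square power3_eq_cube algebra_simps)
    thus ?thesis using False ss by simp
  qed (use n aN in auto)
  have Z: "Z = (\<lambda>\<alpha> z. z \<in> S \<and> - \<gamma> - z - \<alpha>\<^sup>2 * I z = 0)"
    unfolding Z_def Phi_def I_def ..
  note expansion = perturbed_zero_expansion[where I = I and I' = I', OF S D I'_nonneg zero]
  show "\<forall>\<^sub>F \<alpha> in at a. \<exists>!z. Z \<alpha> z"
    unfolding Z by (rule expansion(1))
  show "(\<lambda>\<alpha>. (THE z. Z \<alpha> z) -
           (z0 - s * (2 * n / (a + a ^ 3 * (L2_norm (\<lambda>q. lam q / complex_of_real (b q)))\<^sup>2) * (\<alpha> - a))))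
         \<in> o[at a](\<lambda>\<alpha>. \<alpha> - a)"
    unfolding Z K using expansion(2) unfolding slope by (simp only: mult.assoc)
qed

theorem theorem2p2:
  fixes \<omega> :: "real ^ 'd \<Rightarrow> real" and lam :: "real ^ 'd \<Rightarrow> complex" and \<gamma> :: real
  assumes omega_nonneg: "\<And>q. 0 \<le> \<omega> q"
    and omega_nonconst: "\<not> \<omega> constant_on UNIV"
    and omega_bounded: "bounded (range \<omega>)"
    and omega_cont: "continuous_on UNIV \<omega>"
    and lam_L2: "L2_function lam"
    and lam_nonzero: "\<not> (AE q in lebesgue. lam q = 0)"
  shows
    "(\<gamma> \<le> omega1 \<omega> / 2 - omega0 \<omega> \<longrightarrow>
       (\<forall>\<^sub>F \<alpha> in at_right (alpha2 \<omega> lam \<gamma>). \<exists>!z. is_E_zero \<omega> lam \<gamma> \<alpha> z) \<and>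
       (\<lambda>\<alpha>. E_zero \<omega> lam \<gamma> \<alpha> -
          (2 * omega0 \<omega> - omega1 \<omega> + \<gamma>
           - 2 * (omega1 \<omega> - 2 * omega0 \<omega> - 2 * \<gamma>) /
             (alpha2 \<omega> lam \<gamma> + alpha2 \<omega> lam \<gamma> ^ 3 *
               (L2_norm (\<lambda>q. lam q / complex_of_real (\<omega> q + omega1 \<omega> - 2 * omega0 \<omega>)))\<^sup>2)
             * (\<alpha> - alpha2 \<omega> lam \<gamma>)))
         \<in> o[at_right (alpha2 \<omega> lam \<gamma>)](\<lambda>\<alpha>. \<alpha> - alpha2 \<omega> lam \<gamma>)) \<and>
     (\<gamma> \<ge> omega0 \<omega> / 2 - omega1 \<omega> \<longrightarrow>
       (\<forall>\<^sub>F \<alpha> in at_left (alpha4 \<omega> lam \<gamma>). \<exists>!z. is_F_zero \<omega> lam \<gamma> \<alpha> z) \<and>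
       (\<lambda>\<alpha>. F_zero \<omega> lam \<gamma> \<alpha> -
          (2 * omega1 \<omega> - omega0 \<omega> + \<gamma>
           + 2 * (2 * omega1 \<omega> - omega0 \<omega> + 2 * \<gamma>) /
             (alpha4 \<omega> lam \<gamma> + alpha4 \<omega> lam \<gamma> ^ 3 *
               (L2_norm (\<lambda>q. lam q / complex_of_real (2 * omega1 \<omega> - omega0 \<omega> - \<omega> q)))\<^sup>2)
             * (\<alpha> - alpha4 \<omega> lam \<gamma>)))
         \<in> o[at_left (alpha4 \<omega> lam \<gamma>)](\<lambda>\<alpha>. \<alpha> - alpha4 \<omega> lam \<gamma>))"
proof -
  have bdd: "bdd_above (range \<omega>)" "bdd_below (range \<omega>)"
    by (rule bounded_imp_bdd_above[OF omega_bounded], rule bounded_imp_bdd_below[OF omega_bounded])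
  have lo: "omega0 \<omega> \<le> \<omega> q" and up: "\<omega> q \<le> omega1 \<omega>" for q
    unfolding omega0_def omega1_def using bdd by (auto intro: cINF_lower cSUP_upper)
  \<comment> \<open>Strictness is what puts both limit points into the open intervals:
    \<open>2 * omega0 \<omega> - omega1 \<omega> < omega0 \<omega>\<close> and
    \<open>2 * omega1 \<omega> - omega0 \<omega> > omega1 \<omega>\<close>.\<close>
  have less: "omega0 \<omega> < omega1 \<omega>"
  proof (rule ccontr)
    assume "\<not> omega0 \<omega> < omega1 \<omega>"
    hence "\<omega> q = omega0 \<omega>" for q using lo[of q] up[of q] by linarith
    thus False using omega_nonconst unfolding constant_on_def by blast
  qed
  have \<omega>: "\<omega> \<in> borel_measurable lebesgue"
    using borel_measurable_continuous_onI[OF omega_cont] by (simp add: measurable_completion)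
  \<comment> \<open>One-sided limits come from the two-sided ones. If \<open>alpha4\<close> is 0,
    its left neighbourhood consists of negative couplings; this is harmless because
    \<open>Phi\<close> depends on \<alpha> only through its square.\<close>
  have restrict: "at_right a \<le> at a" "at_left a \<le> at a" for a :: real
    by (simp_all add: at_le)
  show ?thesis
  proof (intro conjI impI)
    assume \<gamma>: "\<gamma> \<le> omega1 \<omega> / 2 - omega0 \<omega>"
    \<comment> \<open>The witness is the distance from \<open>z\<close> to the lower edge of the
      band.\<close>
    have gap: "\<exists>r>0. \<forall>q. r \<le> 1 * (\<omega> q + \<gamma> - z)" if "z \<in> {..<omega0 \<omega> + \<gamma>}" for z
      using that lo by (intro exI[of _ "omega0 \<omega> + \<gamma> - z"]) auto
    note E = critical_expansion[where s = 1 and \<gamma> = \<gamma> and S = "{..<omega0 \<omega> + \<gamma>}"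
        and ?z0.0 = "2 * omega0 \<omega> - omega1 \<omega> + \<gamma>" and n = "omega1 \<omega> - 2 * omega0 \<omega> - 2 * \<gamma>"
        and b = "\<lambda>q. omega1 \<omega> - 2 * omega0 \<omega> + \<omega> q" and a = "alpha2 \<omega> lam \<gamma>",
        OF \<omega> lam_L2 lam_nonzero _ _ _ gap _ _ _ _ alpha2_def]
    have comm: "\<omega> q + omega1 \<omega> - 2 * omega0 \<omega> = omega1 \<omega> - 2 * omega0 \<omega> + \<omega> q" for q by simp
    have "\<forall>\<^sub>F \<alpha> in at (alpha2 \<omega> lam \<gamma>). \<exists>!z. is_E_zero \<omega> lam \<gamma> \<alpha> z"
      unfolding is_E_zero_def using \<gamma> less by (intro E(1)) (auto simp: is_interval_1)
    thus "\<forall>\<^sub>F \<alpha> in at_right (alpha2 \<omega> lam \<gamma>). \<exists>!z. is_E_zero \<omega> lam \<gamma> \<alpha> z"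
      using filter_leD[OF restrict(1)] by blast
    show "(\<lambda>\<alpha>. E_zero \<omega> lam \<gamma> \<alpha> -
          (2 * omega0 \<omega> - omega1 \<omega> + \<gamma>
           - 2 * (omega1 \<omega> - 2 * omega0 \<omega> - 2 * \<gamma>) /
             (alpha2 \<omega> lam \<gamma> + alpha2 \<omega> lam \<gamma> ^ 3 *
               (L2_norm (\<lambda>q. lam q / complex_of_real (\<omega> q + omega1 \<omega> - 2 * omega0 \<omega>)))\<^sup>2)
             * (\<alpha> - alpha2 \<omega> lam \<gamma>)))
         \<in> o[at_right (alpha2 \<omega> lam \<gamma>)](\<lambda>\<alpha>. \<alpha> - alpha2 \<omega> lam \<gamma>)"
      unfolding E_zero_def is_E_zero_def comm
      using landau_o.small.filter_mono[OF restrict(1) E(2)] \<gamma> less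
      by (simp add: is_interval_1)
  next
    assume \<gamma>: "omega0 \<omega> / 2 - omega1 \<omega> \<le> \<gamma>"
    have gap: "\<exists>r>0. \<forall>q. r \<le> - 1 * (\<omega> q + \<gamma> - z)" if "z \<in> {omega1 \<omega> + \<gamma><..}" for z
      using that up by (intro exI[of _ "z - (omega1 \<omega> + \<gamma>)"]) auto
    \<comment> \<open>Above the band \<open>\<omega> q + \<gamma> - z\<close> is negative. With
      \<open>s = - 1\<close> both \<open>b\<close> and \<open>n\<close> become nonnegative, and the
      sign of the slope flips.\<close>
    note F = critical_expansion[where s = "- 1" and \<gamma> = \<gamma> and S = "{omega1 \<omega> + \<gamma><..}"
        and ?z0.0 = "2 * omega1 \<omega> - omega0 \<omega> + \<gamma>" and n = "2 * omega1 \<omega> - omega0 \<omega> + 2 * \<gamma>"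
        and b = "\<lambda>q. 2 * omega1 \<omega> - omega0 \<omega> - \<omega> q" and a = "alpha4 \<omega> lam \<gamma>",
        OF \<omega> lam_L2 lam_nonzero _ _ _ gap _ _ _ _ alpha4_def]
    have "\<forall>\<^sub>F \<alpha> in at (alpha4 \<omega> lam \<gamma>). \<exists>!z. is_F_zero \<omega> lam \<gamma> \<alpha> z"
      unfolding is_F_zero_def using \<gamma> less by (intro F(1)) (auto simp: is_interval_1)
    thus "\<forall>\<^sub>F \<alpha> in at_left (alpha4 \<omega> lam \<gamma>). \<exists>!z. is_F_zero \<omega> lam \<gamma> \<alpha> z"
      using filter_leD[OF restrict(2)] by blast
    show "(\<lambda>\<alpha>. F_zero \<omega> lam \<gamma> \<alpha> -
          (2 * omega1 \<omega> - omega0 \<omega> + \<gamma>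
           + 2 * (2 * omega1 \<omega> - omega0 \<omega> + 2 * \<gamma>) /
             (alpha4 \<omega> lam \<gamma> + alpha4 \<omega> lam \<gamma> ^ 3 *
               (L2_norm (\<lambda>q. lam q / complex_of_real (2 * omega1 \<omega> - omega0 \<omega> - \<omega> q)))\<^sup>2)
             * (\<alpha> - alpha4 \<omega> lam \<gamma>)))
         \<in> o[at_left (alpha4 \<omega> lam \<gamma>)](\<lambda>\<alpha>. \<alpha> - alpha4 \<omega> lam \<gamma>)"
      unfolding F_zero_def is_F_zero_def
      using landau_o.small.filter_mono[OF restrict(2) F(2)] \<gamma> less
      by (simp add: is_interval_1)
  qed
qed

end
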